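(* Let $0\le r<s$ be arbitrary. Then for any $a,b\in\mathbb{R}$, the functions $\varphi^s_{r,a}:\hat\Omega^s_r\to\Lambda^s_{r,a}$ and $\varphi^{s,b}_r:\check\Omega^s_r\to\Lambda^{s,b}_r$ are onto.
   Context: Fix a constant $c>0$. For $0\le r<s$ and $a,b\in\mathbb{R}$ let $F_{r,a}=\{(t,x)\in\mathbb{R}^2: r\le t,\ a-c(t-r)\le x\le a+c(t-r)\}$, $B_{s,b}=\{(t,x)\in\mathbb{R}^2: t\le s,\ b-c(s-t)\le x\le b+c(s-t)\}$, and $P^{s,b}_{r,a}=F_{r,a}\cap B_{s,b}$ (nonempty if and only if $|b-a|\le c(s-r)$). When $P^{s,b}_{r,a}\ne\emptyset$ let $I^{s,b}_{r,a}=\{x\in\mathbb{R}:(\tfrac12(r+s),x)\in P^{s,b}_{r,a}\}$, a (possibly degenerate) closed interval. Also let $I^s_{r,a}=[a-c(s-r),a+c(s-r)]$. Standing assumptions: (i) for all such $r,s,a,b$ with $P^{s,b}_{r,a}\neq\emptyset$ we are given a continuous function $\lambda^{s,b}_{r,a}:[0,1]\to I^{s,b}_{r,a}$ mapping $[0,1]$ onto $I^{s,b}_{r,a}$, such that $(a,b,r,s,\xi)\mapsto\lambda^{s,b}_{r,a}(\xi)$ is continuous on $\{(a,b,r,s,\xi)\in\mathbb{R}^5: 0\le r<s,\ |b-a|\le c(s-r),\ \xi\in[0,1]\}$; (ii) for all $0\le r<s$ and $a\in\mathbb{R}$ we are given a continuous function $\lambda^s_{r,a}:[0,1]\to I^s_{r,a}$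 onto $I^s_{r,a}$, such that $(a,r,s,\xi)\mapsto\lambda^s_{r,a}(\xi)$ is continuous on $\{(a,r,s,\xi):a\in\mathbb{R},\ 0\le r<s,\ \xi\in[0,1]\}$. Let $t_{nj}=r+\frac{j}{2^n}(s-r)$ for $0\le j\le 2^n$, $n\ge 0$; $V^s_{r,n}=\{t_{nj}:0<j<2^n\}$ for $n\ge1$; $V^s_r=\bigcup_{n\ge1}V^s_{r,n}$; $\Omega^s_r=[0,1]^{V^s_r}$; $\hat V^s_r=V^s_r\cup\{s\}$, $\check V^s_r=V^s_r\cup\{r\}$, $\hat\Omega^s_r=[0,1]^{\hat V^s_r}$, $\check\Omega^s_r=[0,1]^{\check V^s_r}$. The maps $\hat\pi:\hat\Omega^s_r\to\Omega^s_r$ and $\check\pi:\check\Omega^s_r\to\Omega^s_r$ are restriction of coordinates to $V^s_r$. Let $\Lambda^s_r$ be the set of continuous $x:[r,s]\to\mathbb{R}$ with $|x(v)-x(u)|\le c|v-u|$ for all $u,v\in[r,s]$; $\Lambda^{s,b}_{r,a}=\{x\in\Lambda^s_r: x(r)=a,\ x(s)=b\}$, $\Lambda^s_{r,a}=\{x\in\Lambda^s_r:x(r)=a\}$, $\Lambda^{s,b}_r=\{x\in\Lambda^s_r:x(s)=b\}$. Definition of $\varphi^{s,b}_{r,a}:\Omega^s_r\to\Lambda^{s,b}_{r,a}$ (when $P^{s,b}_{r,a}\neq\emptyset$): for $\omega\in\Omega^s_r$, the function $\varphi(\omega)=\varphi^{s,b}_{r,a}(\omega)$ is defined on $V^s_r\cup\{r,s\}$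 recursively by $\varphi(\omega)(r)=a$, $\varphi(\omega)(s)=b$, and, for $m\ge1$ and $1\le j\le 2^{m-1}$, writing $a_{m-1,i}=\varphi(\omega)(t_{m-1,i})$, $$\varphi(\omega)(t_{m,2j-1})=\lambda^{t_{m-1,j},a_{m-1,j}}_{t_{m-1,j-1},a_{m-1,j-1}}(\omega_{t_{m,2j-1}})$$ (at each step the relevant set $P^{t_{m-1,j},a_{m-1,j}}_{t_{m-1,j-1},a_{m-1,j-1}}$ is nonempty, and $t_{m,2j}=t_{m-1,j}$). The resulting function is $c$-Lipschitz on the dense set $V^s_r\cup\{r,s\}$ and $\varphi^{s,b}_{r,a}(\omega)\in\Lambda^{s,b}_{r,a}$ denotes its unique continuous extension to $[r,s]$. Definition of $\varphi^s_{r,a}$ and $\varphi^{s,b}_r$: for $\hat\omega\in\hat\Omega^s_r$, $\varphi^s_{r,a}(\hat\omega)=\varphi^{s,b'}_{r,a}(\hat\pi(\hat\omega))$ with $b'=\lambda^s_{r,a}(\hat\omega_s)$; for $\check\omega\in\check\Omega^s_r$, $\varphi^{s,b}_r(\check\omega)=\varphi^{s,b}_{r,a'}(\check\pi(\check\omega))$ with $a'=\lambda^s_{r,b}(\check\omega_r)$. *)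

theory Defs
  imports "HOL-Analysis.Analysis"
begin

text \<open>
  Points of the plane are pairs \<open>(t, x)\<close>. Throughout, an object written with lower indices
  \<open>r, a\<close> and upper indices \<open>s, b\<close> takes its arguments in the order \<open>r a s b\<close>.
\<close>

definition fwd_cone :: "real \<Rightarrow> real \<Rightarrow> real \<Rightarrow> (real \<times> real) set"  \<comment> \<open>\<open>F\<close>\<close>
  where "fwd_cone c r a = {(t, x). r \<le> t \<and> a - c * (t - r) \<le> x \<and> x \<le> a + c * (t - r)}"

definition bwd_cone :: "real \<Rightarrow> real \<Rightarrow> real \<Rightarrow> (real \<times> real) set"  \<comment> \<open>\<open>B\<close>\<close>
  where "bwd_cone c s b = {(t, x). t \<le> s \<and> b - c * (s - t) \<le> x \<and> x \<le> b + c * (s - t)}"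

definition diamond :: "real \<Rightarrow> real \<Rightarrow> real \<Rightarrow> real \<Rightarrow> real \<Rightarrow> (real \<times> real) set"  \<comment> \<open>\<open>P\<close>\<close>
  where "diamond c r a s b = fwd_cone c r a \<inter> bwd_cone c s b"

definition mid_interval :: "real \<Rightarrow> real \<Rightarrow> real \<Rightarrow> real \<Rightarrow> real \<Rightarrow> real set"
  where "mid_interval c r a s b = {x. ((r + s) / 2, x) \<in> diamond c r a s b}"

definition end_interval :: "real \<Rightarrow> real \<Rightarrow> real \<Rightarrow> real \<Rightarrow> real set"
  where "end_interval c r a s = {a - c * (s - r) .. a + c * (s - r)}"

text \<open>
  The two standing assumptions. The families are total functions; nothing is required of
  them at parameters outside the stated ranges.
\<close>

definition mid_family ::
    "real \<Rightarrow> (real \<Rightarrow> real \<Rightarrow> real \<Rightarrow> real \<Rightarrow> real \<Rightarrow> real) \<Rightarrow> bool"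
  where "mid_family c lam \<longleftrightarrow>
    (\<forall>r a s b. 0 \<le> r \<and> r < s \<and> diamond c r a s b \<noteq> {} \<longrightarrow>
       continuous_on {0..1} (lam r a s b) \<and>
       lam r a s b ` {0..1} = mid_interval c r a s b) \<and>
    continuous_on
      {(a, b, r, s, \<xi>). 0 \<le> r \<and> r < s \<and> \<bar>b - a\<bar> \<le> c * (s - r) \<and> \<xi> \<in> {0..1}}
      (\<lambda>(a, b, r, s, \<xi>). lam r a s b \<xi>)"

definition end_family ::
    "real \<Rightarrow> (real \<Rightarrow> real \<Rightarrow> real \<Rightarrow> real \<Rightarrow> real) \<Rightarrow> bool"
  where "end_family c mu \<longleftrightarrow>
    (\<forall>r a s. 0 \<le> r \<and> r < s \<longrightarrow>
       continuous_on {0..1} (mu r a s) \<and>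
       mu r a s ` {0..1} = end_interval c r a s) \<and>
    continuous_on
      {(a, r, s, \<xi>). 0 \<le> r \<and> r < s \<and> \<xi> \<in> {0..1}}
      (\<lambda>(a, r, s, \<xi>). mu r a s \<xi>)"

definition dyad :: "real \<Rightarrow> real \<Rightarrow> nat \<Rightarrow> nat \<Rightarrow> real"  \<comment> \<open>\<open>t\<^sub>n\<^sub>j\<close>\<close>
  where "dyad r s n j = r + real j / 2 ^ n * (s - r)"

definition dyads_level :: "real \<Rightarrow> real \<Rightarrow> nat \<Rightarrow> real set"
  where "dyads_level r s n = {dyad r s n j |j. 0 < j \<and> j < 2 ^ n}"

definition dyads :: "real \<Rightarrow> real \<Rightarrow> real set"  \<comment> \<open>\<open>V\<close>\<close>
  where "dyads r s = (\<Union>n\<in>{1..}. dyads_level r s n)"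

definition dyads_hat :: "real \<Rightarrow> real \<Rightarrow> real set"
  where "dyads_hat r s = dyads r s \<union> {s}"

definition dyads_check :: "real \<Rightarrow> real \<Rightarrow> real set"
  where "dyads_check r s = dyads r s \<union> {r}"

definition Omega_hat :: "real \<Rightarrow> real \<Rightarrow> (real \<Rightarrow> real) set"
  where "Omega_hat r s = dyads_hat r s \<rightarrow>\<^sub>E {0..1}"

definition Omega_check :: "real \<Rightarrow> real \<Rightarrow> (real \<Rightarrow> real) set"
  where "Omega_check r s = dyads_check r s \<rightarrow>\<^sub>E {0..1}"

definition pi_hat :: "real \<Rightarrow> real \<Rightarrow> (real \<Rightarrow> real) \<Rightarrow> (real \<Rightarrow> real)"
  where "pi_hat r s \<omega> = restrict \<omega> (dyads r s)"

definition pi_check :: "real \<Rightarrow> real \<Rightarrow> (real \<Rightarrow> real) \<Rightarrow> (real \<Rightarrow> real)"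
  where "pi_check r s \<omega> = restrict \<omega> (dyads r s)"

text \<open>
  A function on \<open>[r, s]\<close> is represented by its extensional version, so that equality of
  functions is equality on \<open>[r, s]\<close>.
\<close>

definition Lip :: "real \<Rightarrow> real \<Rightarrow> real \<Rightarrow> (real \<Rightarrow> real) set"  \<comment> \<open>\<open>\<Lambda>\<close>\<close>
  where "Lip c r s = {x \<in> extensional {r..s}. continuous_on {r..s} x \<and>
    (\<forall>u\<in>{r..s}. \<forall>v\<in>{r..s}. \<bar>x v - x u\<bar> \<le> c * \<bar>v - u\<bar>)}"

definition Lip_from :: "real \<Rightarrow> real \<Rightarrow> real \<Rightarrow> real \<Rightarrow> (real \<Rightarrow> real) set"
  where "Lip_from c r a s = {x \<in> Lip c r s. x r = a}"

definition Lip_to :: "real \<Rightarrow> real \<Rightarrow> real \<Rightarrow> real \<Rightarrow> (real \<Rightarrow> real) set"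
  where "Lip_to c r s b = {x \<in> Lip c r s. x s = b}"

text \<open>
  \<open>phi_node lam r a s b \<omega> m j\<close> is the value of \<open>\<phi>(\<omega>)\<close> at \<open>dyad r s m j\<close>, for \<open>j \<le> 2 ^ m\<close>.
  An even index \<open>2 i\<close> at level \<open>Suc m\<close> is the point of index \<open>i\<close> at level \<open>m\<close>; an odd index
  \<open>j\<close> is the midpoint of the level-\<open>m\<close> interval with end points of index \<open>j div 2\<close> and
  \<open>Suc (j div 2)\<close>.
\<close>

primrec phi_node ::
    "(real \<Rightarrow> real \<Rightarrow> real \<Rightarrow> real \<Rightarrow> real \<Rightarrow> real) \<Rightarrow> real \<Rightarrow> real \<Rightarrow> real \<Rightarrow> real \<Rightarrow>
     (real \<Rightarrow> real) \<Rightarrow> nat \<Rightarrow> nat \<Rightarrow> real"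
  where
    "phi_node lam r a s b \<omega> 0 j = (if j = 0 then a else b)"
  | "phi_node lam r a s b \<omega> (Suc m) j =
      (let i = j div 2 in
       if even j then phi_node lam r a s b \<omega> m i
       else lam (dyad r s m i) (phi_node lam r a s b \<omega> m i)
                (dyad r s m (Suc i)) (phi_node lam r a s b \<omega> m (Suc i))
                (\<omega> (dyad r s (Suc m) j)))"

text \<open>The unique continuous extension to \<open>[r, s]\<close> of the values at the dyadic points:\<close>

definition phi ::
    "(real \<Rightarrow> real \<Rightarrow> real \<Rightarrow> real \<Rightarrow> real \<Rightarrow> real) \<Rightarrow> real \<Rightarrow> real \<Rightarrow> real \<Rightarrow> real \<Rightarrow>
     (real \<Rightarrow> real) \<Rightarrow> (real \<Rightarrow> real)"
  where "phi lam r a s b \<omega> =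
    (THE x. x \<in> extensional {r..s} \<and> continuous_on {r..s} x \<and>
       (\<forall>m j. j \<le> 2 ^ m \<longrightarrow> x (dyad r s m j) = phi_node lam r a s b \<omega> m j))"

definition phi_from ::
    "(real \<Rightarrow> real \<Rightarrow> real \<Rightarrow> real \<Rightarrow> real \<Rightarrow> real) \<Rightarrow> (real \<Rightarrow> real \<Rightarrow> real \<Rightarrow> real \<Rightarrow> real) \<Rightarrow>
     real \<Rightarrow> real \<Rightarrow> real \<Rightarrow> (real \<Rightarrow> real) \<Rightarrow> (real \<Rightarrow> real)"
  where "phi_from lam mu r a s \<omega> = phi lam r a s (mu r a s (\<omega> s)) (pi_hat r s \<omega>)"

text \<open>The left end point is drawn with \<open>mu r b s\<close>, i.e. from the interval of half-width
  \<open>c (s - r)\<close> around \<open>b\<close>.\<close>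

definition phi_to ::
    "(real \<Rightarrow> real \<Rightarrow> real \<Rightarrow> real \<Rightarrow> real \<Rightarrow> real) \<Rightarrow> (real \<Rightarrow> real \<Rightarrow> real \<Rightarrow> real \<Rightarrow> real) \<Rightarrow>
     real \<Rightarrow> real \<Rightarrow> real \<Rightarrow> (real \<Rightarrow> real) \<Rightarrow> (real \<Rightarrow> real)"
  where "phi_to lam mu r s b \<omega> = phi lam r (mu r b s (\<omega> r)) s b (pi_check r s \<omega>)"

end

theory Submission
  imports Defs
begin

text \<open>
  Everything reduces to paths with both end points fixed: for \<open>\<bar>b - a\<bar> \<le> c (s - r)\<close> the map
  \<open>\<phi>\<close> sends \<open>\<Omega>\<close> onto the \<open>c\<close>-Lipschitz paths from \<open>a\<close> to \<open>b\<close>. A free end point of a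
  \<open>c\<close>-Lipschitz path ranges over exactly the interval of half-width \<open>c (s - r)\<close> around the
  fixed one, and the additional coordinate of \<open>\<omega>\<close> parametrizes that interval.

  The midpoint interval consists of the points within \<open>c (s - r) / 2\<close> of both \<open>a\<close> and \<open>b\<close>
  (\<open>mid_family_image\<close>), so it contains exactly the midpoint values that keep the Lipschitz
  bound on both halves. In one direction, a midpoint inserted there preserves the bound
  between neighbours from level to level; the values at all dyadic points then form a
  Lipschitz function on a dense set, whose extension is the path \<open>\<phi>(\<omega>)\<close> (\<open>phi_mem\<close>). In the
  other direction, the midpoint value of a given \<open>c\<close>-Lipschitz path on any dyadic interval
  lies in the midpoint interval of its two end values, so some parameter in \<open>[0, 1]\<close> produces
  it. Each interior dyadic point is a midpoint of just one dyadic interval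
  (\<open>dyad_odd_unique\<close>), hence these parameters make up one \<open>\<omega>\<close>. By induction on the level
  \<open>\<phi>(\<omega>)\<close> then agrees with the path at all dyadic points, and by continuity everywhere
  (\<open>Lip_coordinates\<close>).
\<close>

section \<open>Dyadic points\<close>

lemma dyad_level_0 [simp]: "dyad r s 0 0 = r" "dyad r s 0 (Suc 0) = s"
  by (auto simp: dyad_def)

lemma dyad_diff: "dyad r s m k - dyad r s m j = (real k - real j) * ((s - r) / 2 ^ m)"
  by (simp add: dyad_def field_simps)

lemma dyad_less_iff: "r < s \<Longrightarrow> dyad r s m j < dyad r s m k \<longleftrightarrow> j < k"
  by (simp add: dyad_def divide_less_cancel)

lemma dyad_mem_Icc:
  assumes "r < s" "j \<le> 2 ^ m"
  shows "dyad r s m j \<in> {r..s}"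
proof -
  have "real j / 2 ^ m \<le> 1"
    using assms(2) by (simp add: divide_le_eq)
  then have "real j / 2 ^ m * (s - r) \<le> 1 * (s - r)"
    using assms(1) by (intro mult_right_mono) auto
  then show ?thesis
    using assms(1) by (simp add: dyad_def)
qed

lemma dyad_refine: "dyad r s (m + k) (2 ^ k * j) = dyad r s m j"
  by (simp add: dyad_def power_add)

lemma dyad_Suc_even: "dyad r s (Suc m) (2 * j) = dyad r s m j"
  by (simp add: dyad_def)

lemma dyad_Suc_odd:
  "dyad r s (Suc m) (Suc (2 * i)) = (dyad r s m i + dyad r s m (Suc i)) / 2"
proof -
  define u where "u = (s - r) / 2 ^ m"
  have "dyad r s m k = r + real k * u" "dyad r s (Suc m) k = r + real k * (u / 2)" for k
    by (simp_all add: dyad_def u_def)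
  then show ?thesis
    by (simp only:) (simp add: field_simps)
qed

text \<open>A fraction with a power of two as denominator is in lowest terms when its numerator is
  odd. Hence a dyadic point is a midpoint at no more than one level, and the requirement that
  a given path puts on the coordinate of \<open>\<omega>\<close> at that point is a single equation.\<close>

lemma dyad_odd_unique:
  assumes "r < s" "odd j" "odd j'" "dyad r s m j = dyad r s m' j'"
  shows "m = m' \<and> j = j'"
proof -
  have eq: "real j * 2 ^ m' = real j' * 2 ^ m"
  proof -
    have "real j / 2 ^ m = real j' / 2 ^ m'"
      using assms(1,4) mult_right_cancel[of "s - r" "real j / 2 ^ m" "real j' / 2 ^ m'"]
      by (simp add: dyad_def)
    then show ?thesis by (simp add: field_simps)
  qed
  have eqn: "j * 2 ^ m' = j' * 2 ^ m"
  proof -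
    have "real (j * 2 ^ m') = real (j' * 2 ^ m)"
      using eq by simp
    then show ?thesis by (simp only: of_nat_eq_iff)
  qed
  have *: "p = q" if "x * 2 ^ q = y * 2 ^ p" "odd y" "p \<le> q" for x y p q :: nat
  proof (rule ccontr)
    assume "p \<noteq> q"
    with \<open>p \<le> q\<close> have "p < q" by simp
    then obtain d where "q = Suc (p + d)"
      using less_imp_Suc_add by blast
    then have "y = x * 2 ^ Suc d"
      using that(1) by (simp add: power_add)
    with \<open>odd y\<close> show False by simp
  qed
  have "m = m'"
    using *[OF eqn assms(3)] *[OF eqn[symmetric] assms(2)] nat_le_linear[of m m'] by blast
  with eqn show ?thesis by simp
qed

lemma dyads_odd:
  assumes "odd j" "j < 2 ^ Suc m"
  shows "dyad r s (Suc m) j \<in> dyads r s"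
proof -
  have "dyad r s (Suc m) j \<in> dyads_level r s (Suc m)"
    unfolding dyads_level_def using assms odd_pos by blast
  then show ?thesis
    unfolding dyads_def by (rule UN_I[rotated]) simp
qed

lemma dyads_subset:
  assumes "r < s"
  shows "dyads r s \<subseteq> {r<..<s}"
proof -
  have "r < dyad r s n j \<and> dyad r s n j < s" if "0 < j" "j < 2 ^ n" for n j
    using dyad_less_iff[OF assms, of n 0 j] dyad_less_iff[OF assms, of n j "2 ^ n"] that
    by (simp add: dyad_def)
  then show ?thesis
    by (auto simp: dyads_def dyads_level_def)
qed

definition all_dyads :: "real \<Rightarrow> real \<Rightarrow> real set"
  where "all_dyads r s = {dyad r s m j |m j. j \<le> 2 ^ m}"

lemma closure_all_dyads:
  assumes "r < s"
  shows "closure (all_dyads r s) = {r..s}"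
proof
  have "all_dyads r s \<subseteq> {r..s}"
    using dyad_mem_Icc[OF assms] unfolding all_dyads_def by blast
  then show "closure (all_dyads r s) \<subseteq> {r..s}"
    by (simp add: closure_minimal)
  show "{r..s} \<subseteq> closure (all_dyads r s)"
  proof
    fix t assume t: "t \<in> {r..s}"
    show "t \<in> closure (all_dyads r s)"
      unfolding closure_approachable
    proof (intro allI impI)
      fix e :: real assume "e > 0"
      then obtain n where n: "(1 / 2) ^ n < e / (s - r)"
        using assms real_arch_pow_inv[of "e / (s - r)" "1/2"] by auto
      define z where "z = (t - r) / (s - r) * 2 ^ n"
      define j where "j = nat \<lfloor>z\<rfloor>"
      have z: "0 \<le> z" "z \<le> 2 ^ n"
        using t assms by (auto simp: z_def divide_le_eq mult_le_cancel_right1)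
      have j: "real j \<le> z" "z < real j + 1"
        using z(1) unfolding j_def by linarith+
      have "real j \<le> real (2 ^ n)"
        using order_trans[OF j(1) z(2)] by simp
      then have "j \<le> 2 ^ n" by (simp only: of_nat_le_iff)
      have "t - dyad r s n j = (z - real j) * ((1 / 2) ^ n * (s - r))"
        using assms by (simp add: z_def dyad_def field_simps)
      moreover have "\<bar>z - real j\<bar> \<le> 1" using j by linarith
      ultimately have "\<bar>t - dyad r s n j\<bar> \<le> 1 * ((1 / 2) ^ n * (s - r))"
        using assms by (simp only: abs_mult, intro mult_mono) (auto simp: abs_mult)
      also have "\<dots> < e"
        using n assms by (simp add: field_simps)
      finally have "dist (dyad r s n j) t < e"
        by (simp add: dist_real_def abs_minus_commute)
      with \<open>j \<le> 2 ^ n\<close> show "\<exists>y\<in>all_dyads r s. dist y t < e"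
        unfolding all_dyads_def by blast
    qed
  qed
qed

section \<open>Values at the dyadic points\<close>

text \<open>The admissible midpoints are those that can be joined to both ends in half the time.
  The average of \<open>a\<close> and \<open>b\<close> is one of them, so the diamond is nonempty.\<close>

lemma mid_family_image:
  assumes "mid_family c lam" "0 \<le> r" "r < s" "\<bar>b - a\<bar> \<le> c * (s - r)"
  shows "lam r a s b ` {0..1} =
    {x. \<bar>x - a\<bar> \<le> c * ((s - r) / 2) \<and> \<bar>b - x\<bar> \<le> c * ((s - r) / 2)}"
proof -
  define h where "h = c * ((s - r) / 2)"
  have half: "(r + s) / 2 - r = (s - r) / 2" "s - (r + s) / 2 = (s - r) / 2"
    by (auto simp: field_simps)
  have order: "r \<le> (r + s) / 2" "(r + s) / 2 \<le> s"
    using assms(3) by simp_all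
  have "x \<in> mid_interval c r a s b \<longleftrightarrow> (a - h \<le> x \<and> x \<le> a + h) \<and> b - h \<le> x \<and> x \<le> b + h" for x
    by (simp only: mid_interval_def diamond_def fwd_cone_def bwd_cone_def h_def half order
        mem_Collect_eq Int_iff prod.case simp_thms)
  moreover have "\<bar>x - a\<bar> \<le> h \<longleftrightarrow> a - h \<le> x \<and> x \<le> a + h"
    "\<bar>b - x\<bar> \<le> h \<longleftrightarrow> b - h \<le> x \<and> x \<le> b + h" for x
    by linarith+
  ultimately have "x \<in> mid_interval c r a s b \<longleftrightarrow> \<bar>x - a\<bar> \<le> h \<and> \<bar>b - x\<bar> \<le> h" for x
    by (simp only:)
  then have mid: "mid_interval c r a s b = {x. \<bar>x - a\<bar> \<le> h \<and> \<bar>b - x\<bar> \<le> h}"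
    by blast
  have "b - a \<le> 2 * h" "a - b \<le> 2 * h"
    using assms(4) by (simp_all add: h_def abs_le_iff)
  then have "(a + b) / 2 \<in> mid_interval c r a s b"
    unfolding mid mem_Collect_eq abs_le_iff by argo
  then have "diamond c r a s b \<noteq> {}"
    unfolding mid_interval_def by blast
  then have "lam r a s b ` {0..1} = mid_interval c r a s b"
    using assms(1-3) by (simp add: mid_family_def)
  then show ?thesis
    by (simp only: mid h_def)
qed

lemma phi_node_refine:
  "phi_node lam r a s b \<omega> (m + k) (2 ^ k * j) = phi_node lam r a s b \<omega> m j"
proof (induction k)
  case 0
  show ?case by simp
next
  case (Suc k)
  have even: "2 ^ Suc k * j = 2 * (2 ^ k * j)"
    by simp
  have "phi_node lam r a s b \<omega> (Suc (m + k)) (2 * i) = phi_node lam r a s b \<omega> (m + k) i" for i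
    by simp
  then show ?case
    using Suc.IH by (simp only: even add_Suc_right)
qed

text \<open>A midpoint inserted at level \<open>Suc m\<close> is within half the allowed distance of both
  neighbours, by the choice of the midpoint interval. The bound at level \<open>m\<close> is in turn what
  makes that interval nonempty, so admissibility is passed on along the recursion.\<close>

lemma phi_node_step:
  assumes lam: "mid_family c lam" and "0 \<le> r" "r < s" "\<bar>b - a\<bar> \<le> c * (s - r)"
    and \<omega>: "\<And>t. t \<in> dyads r s \<Longrightarrow> \<omega> t \<in> {0..1}"
    and "j < 2 ^ m"
  shows "\<bar>phi_node lam r a s b \<omega> m (Suc j) - phi_node lam r a s b \<omega> m j\<bar>
    \<le> c * ((s - r) / 2 ^ m)"
  using \<open>j < 2 ^ m\<close>
proof (induction m arbitrary: j)
  case 0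
  with assms show ?case by simp
next
  case (Suc m)
  define i where "i = j div 2"
  let ?N = "phi_node lam r a s b \<omega>"
  define \<xi> where "\<xi> = \<omega> (dyad r s (Suc m) (Suc (2 * i)))"
  let ?x = "lam (dyad r s m i) (?N m i) (dyad r s m (Suc i)) (?N m (Suc i)) \<xi>"
  have i: "i < 2 ^ m" using Suc.prems by (auto simp: i_def)
  have "Suc (2 * i) < 2 ^ Suc m" using i by simp
  then have "\<xi> \<in> {0..1}"
    unfolding \<xi>_def by (intro \<omega> dyads_odd) auto
  then have "?x \<in> lam (dyad r s m i) (?N m i) (dyad r s m (Suc i)) (?N m (Suc i)) ` {0..1}"
    by (rule imageI)
  moreover have "dyad r s m (Suc i) - dyad r s m i = (s - r) / 2 ^ m"
    by (simp add: dyad_diff)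
  moreover have "0 \<le> dyad r s m i"
    using dyad_mem_Icc[of r s i m] assms i by auto
  moreover have "dyad r s m i < dyad r s m (Suc i)"
    using assms by (simp add: dyad_less_iff)
  ultimately have "\<bar>?x - ?N m i\<bar> \<le> c * ((s - r) / 2 ^ m / 2) \<and>
      \<bar>?N m (Suc i) - ?x\<bar> \<le> c * ((s - r) / 2 ^ m / 2)"
    using mid_family_image[OF lam, of "dyad r s m i" "dyad r s m (Suc i)" "?N m (Suc i)" "?N m i"]
      Suc.IH[OF i] by (simp only: mem_Collect_eq)
  moreover have "?N (Suc m) (Suc (2 * i)) = ?x" "?N (Suc m) (2 * i) = ?N m i"
      "?N (Suc m) (Suc (Suc (2 * i))) = ?N m (Suc i)"
    by (simp_all add: Let_def \<xi>_def)
  moreover have "j = 2 * i \<or> j = Suc (2 * i)"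
    unfolding i_def by presburger
  ultimately show ?case
    by (auto simp: field_simps)
qed

lemma phi_node_Lipschitz_level:
  assumes "mid_family c lam" "0 \<le> r" "r < s" "\<bar>b - a\<bar> \<le> c * (s - r)"
    and "\<And>t. t \<in> dyads r s \<Longrightarrow> \<omega> t \<in> {0..1}"
    and "j \<le> k" "k \<le> 2 ^ m"
  shows "\<bar>phi_node lam r a s b \<omega> m k - phi_node lam r a s b \<omega> m j\<bar>
    \<le> c * (dyad r s m k - dyad r s m j)"
  using \<open>j \<le> k\<close> \<open>k \<le> 2 ^ m\<close>
proof (induction k rule: dec_induct)
  case base
  then show ?case by simp
next
  case (step k)
  have "\<bar>phi_node lam r a s b \<omega> m (Suc k) - phi_node lam r a s b \<omega> m k\<bar>
      \<le> c * (dyad r s m (Suc k) - dyad r s m k)"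
    using phi_node_step[OF assms(1-5), where j = k and m = m] step.prems by (simp add: dyad_diff)
  moreover have "\<bar>phi_node lam r a s b \<omega> m k - phi_node lam r a s b \<omega> m j\<bar>
      \<le> c * (dyad r s m k - dyad r s m j)"
    using step by simp
  ultimately show ?case
    by (simp add: right_diff_distrib)
qed

text \<open>Two dyadic points of different levels are compared at a common finer level. As equal
  points get equal values, this also shows that the values do not depend on how a point is
  written.\<close>

lemma phi_node_Lipschitz:
  assumes "mid_family c lam" "0 \<le> r" "r < s" "\<bar>b - a\<bar> \<le> c * (s - r)"
    and "\<And>t. t \<in> dyads r s \<Longrightarrow> \<omega> t \<in> {0..1}"
    and "j \<le> 2 ^ m" "j' \<le> 2 ^ m'"
  shows "\<bar>phi_node lam r a s b \<omega> m j - phi_node lam r a s b \<omega> m' j'\<bar>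
    \<le> c * \<bar>dyad r s m j - dyad r s m' j'\<bar>"
proof -
  let ?N = "phi_node lam r a s b \<omega> (m + m')" and ?d = "dyad r s (m + m')"
  have level: "\<bar>?N p - ?N q\<bar> \<le> c * \<bar>?d p - ?d q\<bar>"
    if "q \<le> p" "p \<le> 2 ^ (m + m')" for p q
  proof -
    have "?d q \<le> ?d p"
      using \<open>q \<le> p\<close> dyad_less_iff[OF \<open>r < s\<close>] by (metis linorder_not_less)
    then show ?thesis
      using phi_node_Lipschitz_level[OF assms(1-5) that] by simp
  qed
  let ?p = "2 ^ m' * j" and ?q = "2 ^ m * j'"
  have "?p \<le> 2 ^ (m + m')" "?q \<le> 2 ^ (m + m')"
    using assms(6,7) by (simp_all add: power_add mult.commute)
  then have "\<bar>?N ?p - ?N ?q\<bar> \<le> c * \<bar>?d ?p - ?d ?q\<bar>"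
    using level[of ?p ?q] level[of ?q ?p] by (cases "?p \<le> ?q") (auto simp: abs_minus_commute)
  moreover have "?N ?p = phi_node lam r a s b \<omega> m j" "?d ?p = dyad r s m j"
    by (rule phi_node_refine dyad_refine)+
  moreover have "?N ?q = phi_node lam r a s b \<omega> m' j'" "?d ?q = dyad r s m' j'"
    using phi_node_refine[where m = m' and k = m] dyad_refine[where m = m' and k = m]
    by (simp_all add: add.commute)
  ultimately show ?thesis by simp
qed

section \<open>The continuous extension\<close>

text \<open>Dyadic points are dense, so at most one continuous function takes the prescribed values
  there.\<close>

lemma phi_eqI:
  assumes "r < s" "x \<in> extensional {r..s}" "continuous_on {r..s} x"
    and nodes: "\<And>m j. j \<le> 2 ^ m \<Longrightarrow> x (dyad r s m j) = phi_node lam r a s b \<omega> m j"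
  shows "phi lam r a s b \<omega> = x"
  unfolding phi_def
proof (rule the_equality)
  show "x \<in> extensional {r..s} \<and> continuous_on {r..s} x \<and>
      (\<forall>m j. j \<le> 2 ^ m \<longrightarrow> x (dyad r s m j) = phi_node lam r a s b \<omega> m j)"
    using assms by blast
next
  fix y assume y: "y \<in> extensional {r..s} \<and> continuous_on {r..s} y \<and>
      (\<forall>m j. j \<le> 2 ^ m \<longrightarrow> y (dyad r s m j) = phi_node lam r a s b \<omega> m j)"
  have "y t - x t = 0" if "t \<in> {r..s}" for t
  proof (rule continuous_constant_on_closure[of "all_dyads r s" "\<lambda>t. y t - x t"])
    show "continuous_on (closure (all_dyads r s)) (\<lambda>t. y t - x t)"
      using y assms by (auto simp: closure_all_dyads intro!: continuous_intros)
    show "t \<in> closure (all_dyads r s)"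
      using that assms by (simp add: closure_all_dyads)
    show "y u - x u = 0" if "u \<in> all_dyads r s" for u
      using that y nodes unfolding all_dyads_def by auto
  qed
  then show "y = x"
    using y assms(2) by (intro extensionalityI[of y "{r..s}" x]) auto
qed

text \<open>The values at the dyadic points are \<open>c\<close>-Lipschitz, so they extend to the closure with
  the same constant. The ends \<open>a\<close> and \<open>b\<close> are the values at level \<open>0\<close>.\<close>

lemma phi_mem:
  assumes lam: "mid_family c lam" and "0 \<le> r" "r < s" "\<bar>b - a\<bar> \<le> c * (s - r)"
    and \<omega>: "\<And>t. t \<in> dyads r s \<Longrightarrow> \<omega> t \<in> {0..1}"
  shows "phi lam r a s b \<omega> \<in> Lip_from c r a s \<inter> Lip_to c r s b"
proof -
  let ?N = "phi_node lam r a s b \<omega>"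
  have lip: "\<bar>?N m j - ?N m' j'\<bar> \<le> c * \<bar>dyad r s m j - dyad r s m' j'\<bar>"
    if "j \<le> 2 ^ m" "j' \<le> 2 ^ m'" for j m j' m'
    using phi_node_Lipschitz[OF lam assms(2-4) \<omega> that] .
  \<comment> \<open>A point has many indices \<open>(m, j)\<close>; the Lipschitz bound at distance zero shows that the
    choice among them does not matter.\<close>
  define f where "f t = (SOME y. \<exists>m j. j \<le> 2 ^ m \<and> t = dyad r s m j \<and> y = ?N m j)" for t
  have f: "f (dyad r s m j) = ?N m j" if "j \<le> 2 ^ m" for m j
  proof -
    have "\<exists>m' j'. j' \<le> 2 ^ m' \<and> dyad r s m j = dyad r s m' j' \<and> f (dyad r s m j) = ?N m' j'"
      unfolding f_def by (rule someI_ex) (use that in blast)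
    then obtain m' j' where "j' \<le> 2 ^ m'" "dyad r s m j = dyad r s m' j'"
      "f (dyad r s m j) = ?N m' j'" by blast
    then show ?thesis
      using lip[of j m j' m'] that by simp
  qed
  have "0 \<le> c * (s - r)" using assms(4) by (meson abs_ge_zero order_trans)
  then have c: "0 \<le> c" using \<open>r < s\<close> by (simp add: zero_le_mult_iff)
  have "c-lipschitz_on (all_dyads r s) f"
    using c lip by (auto simp: lipschitz_on_def all_dyads_def dist_real_def f)
  then obtain g where g: "c-lipschitz_on {r..s} g" "\<And>t. t \<in> all_dyads r s \<Longrightarrow> g t = f t"
    using lipschitz_extend_closure[of c "all_dyads r s" f] closure_all_dyads[OF \<open>r < s\<close>] by metis
  define x where "x = restrict g {r..s}"
  have x: "c-lipschitz_on {r..s} x"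
    using g(1) by (auto simp: lipschitz_on_def x_def)
  have nodes: "x (dyad r s m j) = ?N m j" if "j \<le> 2 ^ m" for m j
    using g(2)[of "dyad r s m j"] f[OF that] dyad_mem_Icc[OF \<open>r < s\<close> that] that
    by (auto simp: x_def all_dyads_def)
  have cont: "continuous_on {r..s} x"
    using x by (rule lipschitz_on_continuous_on)
  have "phi lam r a s b \<omega> = x"
    using \<open>r < s\<close> cont nodes by (intro phi_eqI) (auto simp: x_def)
  moreover have "x r = a" "x s = b"
    using nodes[of 0 0] nodes[of "Suc 0" 0] by simp_all
  moreover have "x \<in> Lip c r s"
    using x cont by (auto simp: Lip_def lipschitz_on_def dist_real_def x_def)
  ultimately show ?thesis
    by (simp add: Lip_from_def Lip_to_def)
qed

section \<open>Surjectivity\<close>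

lemma Lip_dist:
  assumes "x \<in> Lip c r s" "u \<in> {r..s}" "v \<in> {r..s}"
  shows "\<bar>x v - x u\<bar> \<le> c * \<bar>v - u\<bar>"
  using assms by (simp add: Lip_def)

text \<open>Between neighbouring dyadic points a Lipschitz path takes an admissible midpoint value,
  so the midpoint parametrization attains it at some coordinate. With these coordinates the
  recursion reproduces the path at every dyadic point.\<close>

lemma Lip_coordinates:
  assumes lam: "mid_family c lam" and "0 \<le> r" "r < s" and x: "x \<in> Lip c r s"
  obtains \<omega> where "\<omega> \<in> dyads r s \<rightarrow>\<^sub>E {0..1}" "phi lam r (x r) s (x s) \<omega> = x"
proof -
  let ?d = "dyad r s"
  let ?val = "\<lambda>m i. lam (?d m i) (x (?d m i)) (?d m (Suc i)) (x (?d m (Suc i)))"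
  note lip = Lip_dist[OF x]
  have ex: "\<exists>\<xi>\<in>{0..1}. ?val m i \<xi> = x (?d (Suc m) (Suc (2 * i)))" if i: "i < 2 ^ m" for m i
  proof -
    let ?u = "?d m i" and ?v = "?d m (Suc i)" and ?w = "?d (Suc m) (Suc (2 * i))"
    have u: "?u \<in> {r..s}" and v: "?v \<in> {r..s}" and w: "?w \<in> {r..s}"
      using i \<open>r < s\<close> by (auto intro!: dyad_mem_Icc simp del: atLeastAtMost_iff)
    have uv: "?u < ?v" using \<open>r < s\<close> by (simp add: dyad_less_iff)
    have "?w - ?u = (?v - ?u) / 2" "?v - ?w = (?v - ?u) / 2"
      unfolding dyad_Suc_odd by (simp_all add: field_simps)
    then have "\<bar>?w - ?u\<bar> = (?v - ?u) / 2" "\<bar>?v - ?w\<bar> = (?v - ?u) / 2"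
      using uv by linarith+
    then have "x ?w \<in> {y. \<bar>y - x ?u\<bar> \<le> c * ((?v - ?u) / 2) \<and> \<bar>x ?v - y\<bar> \<le> c * ((?v - ?u) / 2)}"
      using lip[OF u w] lip[OF w v] by (simp only: mem_Collect_eq)
    moreover have "\<bar>x ?v - x ?u\<bar> \<le> c * (?v - ?u)" "0 \<le> ?u"
      using lip[OF u v] uv u \<open>0 \<le> r\<close> by auto
    ultimately have "x ?w \<in> ?val m i ` {0..1}"
      using mid_family_image[OF lam _ uv] by blast
    then show ?thesis by (auto simp: image_iff)
  qed
  define fits where "fits t \<xi> \<longleftrightarrow> \<xi> \<in> {0..1} \<and>
      (\<forall>m i. i < 2 ^ m \<longrightarrow> t = ?d (Suc m) (Suc (2 * i)) \<longrightarrow> ?val m i \<xi> = x t)" for t \<xi>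
  have "\<exists>\<xi>. fits t \<xi>" for t
  proof (cases "\<exists>m i. i < 2 ^ m \<and> t = ?d (Suc m) (Suc (2 * i))")
    case True
    then obtain m i where mi: "i < 2 ^ m" "t = ?d (Suc m) (Suc (2 * i))" by blast
    obtain \<xi> where \<xi>: "\<xi> \<in> {0..1}" "?val m i \<xi> = x t"
      using ex[OF mi(1)] mi(2) by blast
    have "m' = m \<and> i' = i" if "t = ?d (Suc m') (Suc (2 * i'))" for m' i'
      using dyad_odd_unique[OF \<open>r < s\<close>, of "Suc (2 * i')" "Suc (2 * i)" "Suc m'" "Suc m"] that mi
      by simp
    with \<xi> show ?thesis unfolding fits_def by blast
  next
    case False
    then show ?thesis by (intro exI[of _ 0]) (auto simp: fits_def)
  qed
  then obtain w where w: "\<And>t. fits t (w t)" by metis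
  define \<omega> where "\<omega> = restrict w (dyads r s)"
  have nodes: "phi_node lam r (x r) s (x s) \<omega> m j = x (?d m j)" if "j \<le> 2 ^ m" for m j
    using that
  proof (induction m arbitrary: j)
    case 0
    then have "j = 0 \<or> j = Suc 0" by auto
    then show ?case by auto
  next
    case (Suc m)
    define i where "i = j div 2"
    show ?case
    proof (cases "even j")
      case True
      then have "j = 2 * i" by (simp add: i_def)
      then show ?thesis using Suc by (simp add: Let_def dyad_Suc_even)
    next
      case False
      then have j: "j = Suc (2 * i)" unfolding i_def by presburger
      then have i: "i < 2 ^ m" using Suc.prems by simp
      have "?d (Suc m) j \<in> dyads r s"
        by (rule dyads_odd) (use False i j in auto)
      then have "?val m i (\<omega> (?d (Suc m) j)) = x (?d (Suc m) j)"
        using w[of "?d (Suc m) j"] i j by (simp add: fits_def \<omega>_def)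
      then show ?thesis using Suc.IH[of i] Suc.IH[of "Suc i"] i j by (simp add: Let_def)
    qed
  qed
  show thesis
  proof
    show "\<omega> \<in> dyads r s \<rightarrow>\<^sub>E {0..1}"
      using w by (intro PiE_I) (simp_all add: \<omega>_def fits_def)
    show "phi lam r (x r) s (x s) \<omega> = x"
      using x nodes by (intro phi_eqI \<open>r < s\<close>) (auto simp: Lip_def)
  qed
qed

lemma end_family_image:
  assumes "end_family c mu" "0 \<le> r" "r < s"
  shows "mu r a s ` {0..1} = {y. \<bar>y - a\<bar> \<le> c * (s - r)}"
proof -
  have "y \<in> end_interval c r a s \<longleftrightarrow> \<bar>y - a\<bar> \<le> c * (s - r)" for y
    unfolding end_interval_def atLeastAtMost_iff by linarith
  then have "end_interval c r a s = {y. \<bar>y - a\<bar> \<le> c * (s - r)}"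
    by blast
  with assms show ?thesis
    by (simp add: end_family_def)
qed

text \<open>The parameter of the free end \<open>s\<close> and the coordinates for the path with both ends fixed
  can be prescribed together because \<open>s\<close> is not an interior dyadic point.\<close>

lemma phi_from_image:
  assumes lam: "mid_family c lam" and mu: "end_family c mu" and "0 \<le> r" "r < s"
  shows "phi_from lam mu r a s ` Omega_hat r s = Lip_from c r a s"
proof (intro equalityI subsetI)
  fix x assume "x \<in> phi_from lam mu r a s ` Omega_hat r s"
  then obtain \<omega> where \<omega>: "\<omega> \<in> Omega_hat r s" "x = phi_from lam mu r a s \<omega>" by blast
  then have "mu r a s (\<omega> s) \<in> mu r a s ` {0..1}"
    by (intro imageI) (auto simp: Omega_hat_def dyads_hat_def)
  moreover have "pi_hat r s \<omega> t \<in> {0..1}" if "t \<in> dyads r s" for t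
    using \<omega>(1) that by (auto simp: pi_hat_def Omega_hat_def dyads_hat_def)
  ultimately show "x \<in> Lip_from c r a s"
    using phi_mem[OF lam assms(3,4)] \<omega>(2) end_family_image[OF mu assms(3,4)]
    by (auto simp: phi_from_def)
next
  fix x assume "x \<in> Lip_from c r a s"
  then have x: "x \<in> Lip c r s" "x r = a" by (auto simp: Lip_from_def)
  then have "\<bar>x s - a\<bar> \<le> c * (s - r)"
    using \<open>r < s\<close> Lip_dist[of x c r s r s] by simp
  then have "x s \<in> mu r a s ` {0..1}"
    by (simp only: end_family_image[OF mu assms(3,4)] mem_Collect_eq)
  then obtain \<xi> where \<xi>: "\<xi> \<in> {0..1}" "mu r a s \<xi> = x s"
    by (elim imageE) simp
  obtain \<omega> where \<omega>: "\<omega> \<in> dyads r s \<rightarrow>\<^sub>E {0..1}" "phi lam r a s (x s) \<omega> = x"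
    using Lip_coordinates[OF lam assms(3,4) x(1)] x(2) by metis
  have s: "s \<notin> dyads r s" using dyads_subset[OF \<open>r < s\<close>] by auto
  have "fun_upd \<omega> s \<xi> \<in> Omega_hat r s"
    using PiE_fun_upd[OF \<xi>(1) \<omega>(1)] by (simp add: Omega_hat_def dyads_hat_def)
  moreover have "pi_hat r s (fun_upd \<omega> s \<xi>) = \<omega>"
    using \<omega>(1) s by (auto simp: pi_hat_def restrict_def fun_eq_iff PiE_def extensional_def)
  ultimately show "x \<in> phi_from lam mu r a s ` Omega_hat r s"
    using \<omega>(2) \<xi>(2) by (intro image_eqI[of _ _ "fun_upd \<omega> s \<xi>"]) (simp_all add: phi_from_def)
qed

lemma phi_to_image:
  assumes lam: "mid_family c lam" and mu: "end_family c mu" and "0 \<le> r" "r < s"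
  shows "phi_to lam mu r s b ` Omega_check r s = Lip_to c r s b"
proof (intro equalityI subsetI)
  fix x assume "x \<in> phi_to lam mu r s b ` Omega_check r s"
  then obtain \<omega> where \<omega>: "\<omega> \<in> Omega_check r s" "x = phi_to lam mu r s b \<omega>" by blast
  then have "mu r b s (\<omega> r) \<in> mu r b s ` {0..1}"
    by (intro imageI) (auto simp: Omega_check_def dyads_check_def)
  moreover have "pi_check r s \<omega> t \<in> {0..1}" if "t \<in> dyads r s" for t
    using \<omega>(1) that by (auto simp: pi_check_def Omega_check_def dyads_check_def)
  ultimately show "x \<in> Lip_to c r s b"
    using phi_mem[OF lam assms(3,4)] \<omega>(2) end_family_image[OF mu assms(3,4)]
    by (auto simp: phi_to_def abs_minus_commute)
next
  fix x assume "x \<in> Lip_to c r s b"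
  then have x: "x \<in> Lip c r s" "x s = b" by (auto simp: Lip_to_def)
  then have "\<bar>x r - b\<bar> \<le> c * (s - r)"
    using \<open>r < s\<close> Lip_dist[of x c r s s r] by simp
  then have "x r \<in> mu r b s ` {0..1}"
    by (simp only: end_family_image[OF mu assms(3,4)] mem_Collect_eq)
  then obtain \<xi> where \<xi>: "\<xi> \<in> {0..1}" "mu r b s \<xi> = x r"
    by (elim imageE) simp
  obtain \<omega> where \<omega>: "\<omega> \<in> dyads r s \<rightarrow>\<^sub>E {0..1}" "phi lam r (x r) s b \<omega> = x"
    using Lip_coordinates[OF lam assms(3,4) x(1)] x(2) by metis
  have r: "r \<notin> dyads r s" using dyads_subset[OF \<open>r < s\<close>] by auto
  have "fun_upd \<omega> r \<xi> \<in> Omega_check r s"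
    using PiE_fun_upd[OF \<xi>(1) \<omega>(1)] by (simp add: Omega_check_def dyads_check_def)
  moreover have "pi_check r s (fun_upd \<omega> r \<xi>) = \<omega>"
    using \<omega>(1) r by (auto simp: pi_check_def restrict_def fun_eq_iff PiE_def extensional_def)
  ultimately show "x \<in> phi_to lam mu r s b ` Omega_check r s"
    using \<omega>(2) \<xi>(2) by (intro image_eqI[of _ _ "fun_upd \<omega> r \<xi>"]) (simp_all add: phi_to_def)
qed

theorem theorem2p6:
  fixes c r s a b :: real
    and lam :: "real \<Rightarrow> real \<Rightarrow> real \<Rightarrow> real \<Rightarrow> real \<Rightarrow> real"
    and mu :: "real \<Rightarrow> real \<Rightarrow> real \<Rightarrow> real \<Rightarrow> real"
  assumes "c > 0"
    and "mid_family c lam"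
    and "end_family c mu"
    and "0 \<le> r" and "r < s"
  shows "phi_from lam mu r a s ` Omega_hat r s = Lip_from c r a s \<and>
         phi_to lam mu r s b ` Omega_check r s = Lip_to c r s b"
  using phi_from_image[OF assms(2-5)] phi_to_image[OF assms(2-5)] by blast

end
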